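(* Let $G$ be a graph and let $C'=v_0v_1\cdots v_{p-1}v_0$ ($p\ge 3$) be an $id$-cycle of $G$. Then $C'$ is cyclable in $G$; that is, there exists a cycle $C$ in $G$ with $\{v_0,v_1,\ldots,v_{p-1}\}\subseteq V(C)$.
   Context: All graphs are finite, simple and undirected. For a vertex $v$ of a graph $G$, $N(v)$ is its set of neighbours, $d(v)=|N(v)|$ its degree, and $N_2(v)$ the set of vertices at distance exactly $2$ from $v$ in $G$. First implicit-degree $d_1(v)$ of a vertex $v$ in a graph $G$ on $n$ vertices: If $N_2(v)\neq\emptyset$, write $d(v)=k+1$, let $M_2=\max\{d(u): u\in N_2(v)\}$, and let $d_1\le d_2\le\cdots\le d_{k+1}\le d_{k+2}\le\cdots$ be the nondecreasing sequence of the degrees (in $G$) of the vertices in $N(v)\cup N_2(v)$ (with the convention $d_0=0$ if $k=0$). Then $d_1(v)=\max\{d_{k+1},k+1\}$ if $d_{k+1}>M_2$, and $d_1(v)=\max\{d_k,k+1\}$ otherwise. If $N_2(v)=\emptyset$, then $d_1(v)=d(v)$ (which equals $n-1$ when $G$ is connected). (The symbol $d_1(v)$, a function of a vertex, is not to be confused with the first term $d_1$ of the degree sequence.) $id$-cycle (implicit-Dirac-cycle): Let $G$ be a graph on $n$ vertices. A sequence $C'=v_0v_1\cdots v_{p-1}v_0$ with $p\ge3$ and $v_0,\ldots,v_{p-1}$ pairwise distinct vertices of $G$ is an $id$-cycle of $G$ if for every $i$ (indices modulo $p$) either $v_iv_{i+1}\in E(G)$, or both $d_1(v_i)\ge n/2$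 and $d_1(v_{i+1})\ge n/2$. Its vertex set is $V(C')=\{v_0,\ldots,v_{p-1}\}$. *)

theory Defs
  imports Graph_Theory.Graph_Theory "HOL-Library.Multiset"
begin

text \<open>
  A finite simple undirected graph is a \<open>pair_graph\<close>: a finite vertex set with a symmetric,
  irreflexive arc relation, so that an edge \<open>uv\<close> is the pair of arcs \<open>(u, v)\<close>, \<open>(v, u)\<close>.
\<close>

definition nbrs :: "'a pair_pre_digraph \<Rightarrow> 'a \<Rightarrow> 'a set" where
  "nbrs G v = {u. (v, u) \<in> parcs G}"

definition vdeg :: "'a pair_pre_digraph \<Rightarrow> 'a \<Rightarrow> nat" where
  "vdeg G v = card (nbrs G v)"

text \<open>With unit arc weights \<open>\<mu>\<close> is the usual distance in \<open>G\<close> (infinite between components).\<close>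

definition nbrs2 :: "'a pair_pre_digraph \<Rightarrow> 'a \<Rightarrow> 'a set" where
  "nbrs2 G v = {u \<in> pverts G. wf_digraph.\<mu> (with_proj G) (\<lambda>_. 1) v u = 2}"

text \<open>\<open>deg_seq G v j\<close> is the \<open>j\<close>-th term \<open>d\<^sub>j\<close>, counted from \<open>1\<close>, of the nondecreasing degree
  sequence of \<open>N(v) \<union> N\<^sub>2(v)\<close>, with \<open>d\<^sub>0 = 0\<close>.\<close>

definition deg_seq :: "'a pair_pre_digraph \<Rightarrow> 'a \<Rightarrow> nat \<Rightarrow> nat" where
  "deg_seq G v j =
     (if j = 0 then 0
      else sorted_list_of_multiset
             (image_mset (vdeg G) (mset_set (nbrs G v \<union> nbrs2 G v))) ! (j - 1))"

text \<open>In the second branch \<open>v\<close> has a neighbour, so the subtraction defining \<open>k\<close> does not truncate.\<close>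

definition implicit_deg1 :: "'a pair_pre_digraph \<Rightarrow> 'a \<Rightarrow> nat" where
  "implicit_deg1 G v =
     (if nbrs2 G v = {} then vdeg G v
      else let k = vdeg G v - 1;
               M2 = Max (vdeg G ` nbrs2 G v)
           in if deg_seq G v (k + 1) > M2
              then max (deg_seq G v (k + 1)) (k + 1)
              else max (deg_seq G v k) (k + 1))"

definition id_cycle :: "'a pair_pre_digraph \<Rightarrow> 'a list \<Rightarrow> bool" where
  "id_cycle G vs \<longleftrightarrow>
     3 \<le> length vs \<and> distinct vs \<and> set vs \<subseteq> pverts G \<and>
     (\<forall>i < length vs.
        let v = vs ! i; w = vs ! ((i + 1) mod length vs); n = card (pverts G)
        in (v, w) \<in> parcs G \<or>
           (real (implicit_deg1 G v) \<ge> real n / 2 \<and> real (implicit_deg1 G w) \<ge> real n / 2))"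

text \<open>The library's \<open>cycle\<close> is directed and admits \<open>u, v, u\<close>; requiring length at least \<open>3\<close> leaves
  exactly the cycles of the undirected graph. Every vertex of a cycle is the tail of one of its
  arcs.\<close>

definition cyclable :: "'a pair_pre_digraph \<Rightarrow> 'a set \<Rightarrow> bool" where
  "cyclable G S \<longleftrightarrow>
     (\<exists>c. pre_digraph.cycle (with_proj G) c \<and> 3 \<le> length c \<and> S \<subseteq> fst ` set c)"

end

theory Submission
  imports Defs
begin

text \<open>
  Call a vertex of implicit degree at least \<open>n/2\<close> heavy. An id-cycle is a cyclic sequence in which
  consecutive vertices are adjacent or both heavy; call a non-adjacent consecutive pair a gap.
  Among all such sequences through the prescribed set, take one with the fewest gaps. If there is
  none left, the sequence is a cycle of the graph. Otherwise cut the sequence at a gap: this gives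
  a path-like list from \<open>u\<close> to \<open>v\<close> with \<open>u\<close> and \<open>v\<close> heavy and not adjacent.

  If both ends had degree at least \<open>n/2\<close>, Ore's crossing argument would close the list without the
  gap \<open>vu\<close>: either \<open>u\<close> and \<open>v\<close> have a common neighbour off the list, or some consecutive \<open>x, y\<close> on it
  satisfy \<open>uy, vx \<in> E\<close> (\<open>not_both_ends_high_degree\<close>).

  It remains to replace an end \<open>u\<close> of smaller degree by one of degree at least \<open>n/2\<close>, keeping the
  other end and the number of gaps (\<open>high_degree_hd\<close>). A neighbour of \<open>u\<close> off the list can be put
  in front of \<open>u\<close>, and if \<open>y\<close> is a neighbour of \<open>u\<close> on the list, then reversing the part before \<open>y\<close>
  makes the predecessor of \<open>y\<close> the new first vertex. These \<open>d(u)\<close> vertices are distinct, and apart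
  from \<open>u\<close> itself all of them lie in \<open>N(u) \<union> N\<^sub>2(u)\<close>. Suppose that none of them has degree at least
  \<open>n/2\<close>. The definition of the implicit degree then leaves one possibility
  (\<open>implicit_degree_witnesses\<close>): \<open>u\<close> is among them, they contain all of \<open>N\<^sub>2(u)\<close>, and every neighbour
  of \<open>u\<close> that is not among them has degree at least \<open>n/2\<close>. The last neighbour \<open>w\<close> of \<open>u\<close> on the list
  is not the predecessor of a neighbour, so it has degree at least \<open>n/2\<close>. Its successor \<open>q\<close> is
  neither a neighbour of \<open>u\<close> nor the predecessor of one, so \<open>q\<close> is outside \<open>N\<^sub>2(u)\<close> and \<open>wq\<close> must be
  a gap. Now reversing the part up to \<open>w\<close> trades the gap \<open>wq\<close> for the pair \<open>uq\<close> of heavy vertices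
  and makes \<open>w\<close> the first vertex after all.
\<close>

section \<open>Heavy vertices and linked sequences\<close>

definition high_degree :: "'a pair_pre_digraph \<Rightarrow> 'a \<Rightarrow> bool" where
  "high_degree G v \<longleftrightarrow> card (pverts G) \<le> 2 * vdeg G v"

definition heavy :: "'a pair_pre_digraph \<Rightarrow> 'a \<Rightarrow> bool" where
  "heavy G v \<longleftrightarrow> card (pverts G) \<le> 2 * implicit_deg1 G v"

definition linked :: "'a pair_pre_digraph \<Rightarrow> 'a \<Rightarrow> 'a \<Rightarrow> bool" where
  "linked G x y \<longleftrightarrow> (x, y) \<in> parcs G \<or> heavy G x \<and> heavy G y"

definition gaps :: "'a pair_pre_digraph \<Rightarrow> 'a list \<Rightarrow> nat" where
  "gaps G xs = length (filter (\<lambda>e. e \<notin> parcs G) (vwalk_arcs xs))"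

text \<open>A cyclic sequence is represented by a list without repetition of the first vertex.\<close>

definition cyclic_gaps :: "'a pair_pre_digraph \<Rightarrow> 'a list \<Rightarrow> nat" where
  "cyclic_gaps G xs = gaps G (xs @ [hd xs])"

definition linked_cycle :: "'a pair_pre_digraph \<Rightarrow> 'a set \<Rightarrow> 'a list \<Rightarrow> bool" where
  "linked_cycle G S xs \<longleftrightarrow>
     xs \<noteq> [] \<and> distinct xs \<and> S \<subseteq> set xs \<and> set xs \<subseteq> pverts G \<and>
     successively (linked G) (xs @ [hd xs])"

section \<open>Implicit degrees\<close>

lemma sorted_nth_less:
  fixes L :: "nat list"
  assumes "sorted L" and "j \<le> length (filter (\<lambda>x. x < b) L)" and "0 < j"
  shows "L ! (j - 1) < b"
proof (rule ccontr)
  assume c: "\<not> L ! (j - 1) < b"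
  have "{i. i < length L \<and> L ! i < b} \<subseteq> {..<j - 1}"
  proof
    fix i assume i: "i \<in> {i. i < length L \<and> L ! i < b}"
    show "i \<in> {..<j - 1}"
    proof (rule ccontr)
      assume "i \<notin> {..<j - 1}"
      then have "L ! (j - 1) \<le> L ! i"
        using i by (auto intro: sorted_nth_mono[OF assms(1)])
      then show False using c i by auto
    qed
  qed
  then have "card {i. i < length L \<and> L ! i < b} \<le> j - 1"
    by (metis card_lessThan card_mono finite_lessThan)
  then show False using assms(2,3) by (simp add: length_filter_conv_card)
qed

lemma deg_seq_less:
  assumes "finite (nbrs G v \<union> nbrs2 G v)" and "0 < j"
    and "j \<le> card {w \<in> nbrs G v \<union> nbrs2 G v. vdeg G w < b}"
  shows "deg_seq G v j < b"
proof -
  let ?W = "nbrs G v \<union> nbrs2 G v"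
  let ?D = "image_mset (vdeg G) (mset_set ?W)"
  let ?L = "sorted_list_of_multiset ?D"
  have "length (filter (\<lambda>x. x < b) ?L) = size (filter_mset (\<lambda>x. x < b) ?D)"
    by (metis mset_filter mset_sorted_list_of_multiset size_mset)
  also have "\<dots> = card {w \<in> ?W. vdeg G w < b}"
    using assms(1) by (simp add: filter_mset_image_mset filter_mset_mset_set)
  finally have "?L ! (j - 1) < b"
    using sorted_nth_less[of ?L j b] assms(2,3) by simp
  then show ?thesis using assms(2) by (simp add: deg_seq_def)
qed

lemma vdeg_le_implicit_deg1: "vdeg G v \<le> implicit_deg1 G v"
  by (auto simp: implicit_deg1_def Let_def)

lemma high_degree_imp_heavy: "high_degree G v \<Longrightarrow> heavy G v"
  using vdeg_le_implicit_deg1[of G v] by (auto simp: high_degree_def heavy_def)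

context pair_graph
begin

lemma finite_nbrs [simp]: "finite (nbrs G v)"
proof -
  have "nbrs G v \<subseteq> pverts G" by (auto simp: nbrs_def dest: in_arcsD2)
  then show ?thesis using pair_finite_verts finite_subset by blast
qed

lemma finite_nbrs2 [simp]: "finite (nbrs2 G v)"
  using pair_finite_verts by (simp add: nbrs2_def)

text \<open>Distance exactly \<open>2\<close>: a walk of length at most \<open>1\<close> would give \<open>q = u\<close> or \<open>q \<in> N(u)\<close>.\<close>

lemma mem_nbrs2I:
  assumes "(u, y) \<in> parcs G" and "(y, q) \<in> parcs G" and "q \<noteq> u" and "q \<notin> nbrs G u"
  shows "q \<in> nbrs2 G u"
proof -
  have "\<mu> (\<lambda>_. 1) u q = 2"
    unfolding \<mu>_def
  proof (rule INF_eqI)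
    fix p assume p: "p \<in> {p. awalk u p q}"
    have "2 \<le> length p"
    proof (rule ccontr)
      assume "\<not> 2 \<le> length p"
      then consider "p = []" | e where "p = [e]"
        by (cases p) (auto simp: Suc_le_eq)
      then show False
        using p assms(3,4) by cases (auto simp: awalk_def nbrs_def)
    qed
    then show "2 \<le> ereal (awalk_cost (\<lambda>_. 1) p)"
      by (simp add: awalk_cost_def sum_list_triv)
  next
    fix b :: ereal
    assume b: "\<And>p. p \<in> {p. awalk u p q} \<Longrightarrow> b \<le> ereal (awalk_cost (\<lambda>_. 1) p)"
    have "awalk u [(u, y), (y, q)] q"
      using assms(1,2) by (auto simp: awalk_def dest: in_arcsD1)
    from b[of "[(u, y), (y, q)]"] this show "b \<le> 2"
      by (simp add: awalk_cost_def)
  qed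
  then show ?thesis
    using assms(2) by (auto simp: nbrs2_def dest: in_arcsD2)
qed

text \<open>
  Write \<open>d(u) = k + 1\<close>. The set \<open>T\<close> has at least \<open>k\<close> elements, all of degree below \<open>n/2\<close>, so \<open>d\<^sub>k\<close>
  is below \<open>n/2\<close>, and so is \<open>k + 1\<close>. An implicit degree of at least \<open>n/2\<close> can therefore only be
  \<open>d\<^bsub>k+1\<^esub>\<close>, with \<open>d\<^bsub>k+1\<^esub> > M\<^sub>2\<close>. At most \<open>k\<close> members of \<open>N(u) \<union> N\<^sub>2(u)\<close> have degree below \<open>d\<^bsub>k+1\<^esub>\<close>;
  these include \<open>T\<close> and, because of \<open>M\<^sub>2\<close>, all of \<open>N\<^sub>2(u)\<close>. Hence they are exactly the members of
  \<open>T\<close>, and everything outside \<open>T\<close> has degree at least \<open>d\<^bsub>k+1\<^esub> \<ge> n/2\<close>.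
\<close>

lemma implicit_degree_witnesses:
  assumes "heavy G u" and "\<not> high_degree G u" and "3 \<le> card (pverts G)"
    and T: "T \<subseteq> nbrs G u \<union> nbrs2 G u" "\<And>t. t \<in> T \<Longrightarrow> \<not> high_degree G t"
    and card_T: "vdeg G u \<le> card T + 1"
  shows "card T < vdeg G u" and "nbrs2 G u \<subseteq> T"
    and "\<And>w. w \<in> nbrs G u - T \<Longrightarrow> high_degree G w"
proof -
  let ?n = "card (pverts G)"
  let ?W = "nbrs G u \<union> nbrs2 G u"
  define k where "k = vdeg G u - 1"
  define b where "b = deg_seq G u (k + 1)"
  define L where "L = {w \<in> ?W. vdeg G w < b}"
  have finW: "finite ?W" by simp
  have finT: "finite T" using T(1) finW finite_subset by blast
  have low: "2 * vdeg G u < ?n" using assms(2) by (simp add: high_degree_def)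
  have N2: "nbrs2 G u \<noteq> {}"
    using assms(1) low by (auto simp: heavy_def implicit_deg1_def)
  have kT: "k \<le> card T" using card_T by (simp add: k_def)
  have dk: "2 * deg_seq G u k < ?n"
  proof (cases "k = 0")
    case True
    then show ?thesis using low by (simp add: deg_seq_def)
  next
    case False
    \<comment> \<open>For integers \<open>d\<close>, the condition \<open>2 d < n\<close> is equivalent to \<open>d < \<lceil>n/2\<rceil>\<close>.\<close>
    let ?c = "(?n + 1) div 2"
    have "T \<subseteq> {w \<in> ?W. vdeg G w < ?c}"
      using T by (fastforce simp: high_degree_def)
    then have "k \<le> card {w \<in> ?W. vdeg G w < ?c}"
      using kT card_mono[of "{w \<in> ?W. vdeg G w < ?c}" T] finW by fastforce
    then have "deg_seq G u k < ?c" using False by (intro deg_seq_less) auto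
    then show ?thesis by linarith
  qed
  \<comment> \<open>If \<open>d(u) = 0\<close>, then \<open>k + 1\<close> is \<open>1\<close> rather than \<open>d(u)\<close>; this case needs \<open>n \<ge> 3\<close>.\<close>
  have k1: "2 * (k + 1) < ?n" using low assms(3) by (cases "vdeg G u") (auto simp: k_def)
  have above: "Max (vdeg G ` nbrs2 G u) < b \<and> ?n \<le> 2 * b"
  proof -
    let ?M = "Max (vdeg G ` nbrs2 G u)"
    have "implicit_deg1 G u = (if ?M < b then max b (k + 1) else max (deg_seq G u k) (k + 1))"
      using N2 unfolding implicit_deg1_def Let_def k_def b_def by simp
    then show ?thesis using assms(1) dk k1 by (auto simp: heavy_def max_def split: if_splits)
  qed
  have cL: "card L \<le> k"
    using deg_seq_less[OF finW, of "k + 1" b] unfolding L_def b_def by fastforce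
  have finL: "finite L" using finW by (simp add: L_def)
  have TL: "T \<subseteq> L" using T above by (fastforce simp: L_def high_degree_def)
  have N2L: "nbrs2 G u \<subseteq> L"
  proof
    fix w assume w: "w \<in> nbrs2 G u"
    then have "vdeg G w \<le> Max (vdeg G ` nbrs2 G u)" by simp
    moreover have "Max (vdeg G ` nbrs2 G u) < b" using above ..
    ultimately have "vdeg G w < b" by (rule le_less_trans)
    then show "w \<in> L" using w by (simp add: L_def)
  qed
  have eq: "T = L" using TL finL cL kT by (meson card_seteq order_trans)
  show "nbrs2 G u \<subseteq> T" using N2L eq by simp
  have "card L > 0" using N2L N2 finL by (metis card_gt_0_iff subset_empty)
  then show "card T < vdeg G u" using eq cL by (simp add: k_def)
  show "high_degree G w" if "w \<in> nbrs G u - T" for w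
    using that above by (auto simp: eq L_def high_degree_def)
qed

end

section \<open>Linked cycles\<close>

lemma gaps_append:
  assumes "ps \<noteq> []" and "qs \<noteq> []"
  shows "gaps G (ps @ qs) =
    gaps G ps + gaps G qs + (if (last ps, hd qs) \<in> parcs G then 0 else 1)"
  using assms by (simp add: gaps_def vwalk_arcs_append)

lemma gaps_Cons:
  "xs \<noteq> [] \<Longrightarrow> gaps G (x # xs) = gaps G xs + (if (x, hd xs) \<in> parcs G then 0 else 1)"
  by (simp add: gaps_def)

lemma gaps_singleton [simp]: "gaps G [x] = 0"
  by (simp add: gaps_def)

lemma cyclic_gaps_eq:
  "xs \<noteq> [] \<Longrightarrow>
    cyclic_gaps G xs = gaps G xs + (if (last xs, hd xs) \<in> parcs G then 0 else 1)"
  by (simp add: cyclic_gaps_def gaps_append)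

lemma cyclic_gaps_append:
  assumes "ps \<noteq> []" and "qs \<noteq> []"
  shows "cyclic_gaps G (ps @ qs) = gaps G ps + gaps G qs
    + (if (last ps, hd qs) \<in> parcs G then 0 else 1)
    + (if (last qs, hd ps) \<in> parcs G then 0 else 1)"
  using assms by (simp add: cyclic_gaps_eq gaps_append)

lemma linked_cycle_eq:
  "linked_cycle G S xs \<longleftrightarrow> xs \<noteq> [] \<and> distinct xs \<and> S \<subseteq> set xs \<and> set xs \<subseteq> pverts G \<and>
    successively (linked G) xs \<and> linked G (last xs) (hd xs)"
  by (auto simp: linked_cycle_def successively_append_iff)

lemma linked_cycle_append:
  assumes "ps \<noteq> []" and "qs \<noteq> []"
  shows "linked_cycle G S (ps @ qs) \<longleftrightarrow>
    distinct (ps @ qs) \<and> S \<subseteq> set (ps @ qs) \<and> set (ps @ qs) \<subseteq> pverts G \<and>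
    successively (linked G) ps \<and> successively (linked G) qs \<and>
    linked G (last ps) (hd qs) \<and> linked G (last qs) (hd ps)"
  using assms by (auto simp: linked_cycle_eq successively_append_iff)

lemma gap_split:
  assumes "0 < gaps G xs"
  shows "\<exists>ps qs. xs = ps @ qs \<and> ps \<noteq> [] \<and> qs \<noteq> [] \<and> (last ps, hd qs) \<notin> parcs G"
  using assms
proof (induction xs rule: vwalk_arcs.induct)
  case (3 x y xs)
  show ?case
  proof (cases "(x, y) \<in> parcs G")
    case True
    then have "0 < gaps G (y # xs)" using 3(2) by (simp add: gaps_def)
    then obtain ps qs where "y # xs = ps @ qs" "ps \<noteq> []" "qs \<noteq> []" "(last ps, hd qs) \<notin> parcs G"
      using 3(1) by blast
    then show ?thesis by (intro exI[of _ "x # ps"] exI[of _ qs]) auto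
  next
    case False
    then show ?thesis by (intro exI[of _ "[x]"] exI[of _ "y # xs"]) auto
  qed
qed (auto simp: gaps_def)

lemma split_at:
  assumes "Suc j < length xs"
  obtains ps qs where "xs = ps @ qs" and "ps \<noteq> []" and "qs \<noteq> []"
    and "last ps = xs ! j" and "hd qs = xs ! Suc j"
proof
  show "xs = take (Suc j) xs @ drop (Suc j) xs" by simp
  show "last (take (Suc j) xs) = xs ! j"
    using assms by (simp add: take_Suc_conv_app_nth)
  show "hd (drop (Suc j) xs) = xs ! Suc j"
    using assms by (simp add: hd_drop_conv_nth)
qed (use assms in auto)

context pair_graph
begin

lemma gaps_rev: "gaps G (rev xs) = gaps G xs"
proof (induction xs)
  case (Cons x xs)
  then show ?case
    by (cases "xs = []") (auto simp: gaps_append gaps_Cons last_rev intro: arcs_symmetric)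
qed simp

lemma linked_sym: "linked G x y \<longleftrightarrow> linked G y x"
  by (auto simp: linked_def intro: arcs_symmetric)

lemma successively_linked_rev: "successively (linked G) (rev xs) = successively (linked G) xs"
  by (simp add: linked_sym[symmetric])

text \<open>
  Reversing an initial segment of a cyclic list replaces two of its consecutive pairs and keeps all
  others. Up to rotation and reflection, this and prepending a vertex are the only changes made to
  cyclic lists below.
\<close>

lemma linked_cycle_flip:
  assumes "linked_cycle G S (ps @ qs)" and "ps \<noteq> []" and "qs \<noteq> []"
    and "linked G (hd ps) (hd qs)" and "linked G (last qs) (last ps)"
  shows "linked_cycle G S (rev ps @ qs)"
  using assms
  by (simp add: linked_cycle_append successively_linked_rev hd_rev last_rev del: successively_rev)

lemma cyclic_gaps_flip:
  assumes "ps \<noteq> []" and "qs \<noteq> []"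
  shows "cyclic_gaps G (rev ps @ qs) = gaps G ps + gaps G qs
    + (if (hd ps, hd qs) \<in> parcs G then 0 else 1)
    + (if (last qs, last ps) \<in> parcs G then 0 else 1)"
  using assms by (simp add: cyclic_gaps_append gaps_rev hd_rev last_rev)

lemma linked_cycle_rotate:
  assumes "linked_cycle G S (ps @ qs)"
  shows "linked_cycle G S (qs @ ps)"
  using assms
  by (cases "ps = []"; cases "qs = []") (auto simp: linked_cycle_append)

lemma cyclic_gaps_rotate: "cyclic_gaps G (ps @ qs) = cyclic_gaps G (qs @ ps)"
  by (cases "ps = []"; cases "qs = []") (simp_all add: cyclic_gaps_append)

lemma linked_cycle_rev: "linked_cycle G S xs \<Longrightarrow> linked_cycle G S (rev xs)"
  by (auto simp: linked_cycle_eq successively_linked_rev hd_rev last_rev linked_sym)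

lemma cyclic_gaps_rev: "xs \<noteq> [] \<Longrightarrow> cyclic_gaps G (rev xs) = cyclic_gaps G xs"
  by (auto simp: cyclic_gaps_eq gaps_rev hd_rev last_rev intro: arcs_symmetric)

lemma linked_cycle_Cons:
  assumes "linked_cycle G S xs" and "y \<notin> set xs" and "(y, hd xs) \<in> parcs G"
    and "linked G (last xs) y"
  shows "linked_cycle G S (y # xs)"
  using assms by (auto simp: linked_cycle_eq successively_Cons linked_def dest: in_arcsD1)

lemma cyclic_gaps_Cons:
  assumes "xs \<noteq> []" and "(y, hd xs) \<in> parcs G"
  shows "cyclic_gaps G (y # xs) = gaps G xs + (if (last xs, y) \<in> parcs G then 0 else 1)"
  using assms by (simp add: cyclic_gaps_eq gaps_Cons)

text \<open>The lower bound on the size of \<open>S\<close> excludes the degenerate closed walk along a single edge.\<close>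

lemma cyclable_if_gap_free:
  assumes "linked_cycle G S xs" and "3 \<le> card S" and "cyclic_gaps G xs = 0"
  shows "cyclable G S"
proof -
  let ?c = "vwalk_arcs (xs @ [hd xs])"
  have ne: "xs \<noteq> []" using assms(1) by (simp add: linked_cycle_def)
  have arcs: "set ?c \<subseteq> parcs G"
    using assms(3) by (auto simp: cyclic_gaps_def gaps_def filter_empty_conv)
  have verts: "pawalk_verts (hd ws) (vwalk_arcs ws) = ws" if "ws \<noteq> []" for ws :: "'a list"
    using that by (induction ws rule: vwalk_arcs.induct) auto
  have cas: "pcas (hd ws) (vwalk_arcs ws) (last ws)" if "ws \<noteq> []" for ws :: "'a list"
    using that by (induction ws rule: vwalk_arcs.induct) auto
  have tails: "map fst (vwalk_arcs (ws @ [x])) = ws" for ws and x :: 'a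
    by (induction ws) simp_all
  have "awalk (hd xs) ?c (hd xs)"
    using assms(1) arcs cas[of "xs @ [hd xs]"] ne by (auto simp: awalk_def linked_cycle_def)
  moreover have "distinct (tl (pawalk_verts (hd xs) ?c))"
    using verts[of "xs @ [hd xs]"] ne assms(1)
    by (cases xs) (auto simp: linked_cycle_def)
  moreover have "3 \<le> length ?c"
  proof -
    have "card S \<le> card (set xs)"
      using assms(1) by (intro card_mono) (auto simp: linked_cycle_def)
    also have "\<dots> \<le> length xs" by (rule card_length)
    finally show ?thesis using assms(2) by (simp flip: vwalk_length_def)
  qed
  moreover have "S \<subseteq> fst ` set ?c"
    using tails[of xs "hd xs"] assms(1) by (metis linked_cycle_def set_map)
  ultimately show ?thesis
    unfolding cyclable_def by (intro exI[of _ ?c]) (auto simp: cycle_def)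
qed

text \<open>
  The neighbours of both ends of a path are indexed by the consecutive pairs \<open>(xs ! j, xs ! Suc j)\<close>:
  a neighbour of the first vertex by the pair in which it comes second, a neighbour of the last
  vertex by the pair in which it comes first. A crossing is then a common index.
\<close>

lemma card_hd_nbrs_in_path:
  assumes "distinct xs" and "xs \<noteq> []"
  shows "card (nbrs G (hd xs) \<inter> set xs) =
    card {j. Suc j < length xs \<and> (hd xs, xs ! Suc j) \<in> parcs G}"
proof -
  let ?A = "{j. Suc j < length xs \<and> (hd xs, xs ! Suc j) \<in> parcs G}"
  have eq: "nbrs G (hd xs) \<inter> set xs = (\<lambda>j. xs ! Suc j) ` ?A"
  proof
    show "nbrs G (hd xs) \<inter> set xs \<subseteq> (\<lambda>j. xs ! Suc j) ` ?A"
    proof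
      fix y assume y: "y \<in> nbrs G (hd xs) \<inter> set xs"
      then obtain i where i: "i < length xs" "y = xs ! i" by (auto simp: in_set_conv_nth)
      have "i \<noteq> 0"
      proof
        assume "i = 0"
        then have "y = hd xs" using i assms(2) by (simp add: hd_conv_nth)
        then show False using y by (auto simp: nbrs_def dest: no_loops')
      qed
      then obtain j where "i = Suc j" by (cases i) auto
      then show "y \<in> (\<lambda>j. xs ! Suc j) ` ?A" using i y by (auto simp: nbrs_def)
    qed
  qed (auto simp: nbrs_def)
  have "inj_on (\<lambda>j. xs ! Suc j) ?A"
    using assms(1) by (auto simp: inj_on_def nth_eq_iff_index_eq)
  then show ?thesis unfolding eq by (rule card_image)
qed

lemma card_last_nbrs_in_path:
  assumes "distinct xs" and "xs \<noteq> []"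
  shows "card (nbrs G (last xs) \<inter> set xs) =
    card {j. Suc j < length xs \<and> (last xs, xs ! j) \<in> parcs G}"
proof -
  let ?B = "{j. Suc j < length xs \<and> (last xs, xs ! j) \<in> parcs G}"
  have eq: "nbrs G (last xs) \<inter> set xs = (\<lambda>j. xs ! j) ` ?B"
  proof
    show "nbrs G (last xs) \<inter> set xs \<subseteq> (\<lambda>j. xs ! j) ` ?B"
    proof
      fix y assume y: "y \<in> nbrs G (last xs) \<inter> set xs"
      then obtain i where i: "i < length xs" "y = xs ! i" by (auto simp: in_set_conv_nth)
      have "y \<noteq> last xs" using y by (auto simp: nbrs_def dest: no_loops')
      moreover have "last xs = xs ! (length xs - 1)" using assms(2) by (rule last_conv_nth)
      ultimately have "i \<noteq> length xs - 1" using i(2) by metis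
      then have "Suc i < length xs" using i(1) by linarith
      then show "y \<in> (\<lambda>j. xs ! j) ` ?B" using i y by (auto simp: nbrs_def)
    qed
  qed (auto simp: nbrs_def)
  have "inj_on (\<lambda>j. xs ! j) ?B"
    using assms(1) by (auto simp: inj_on_def nth_eq_iff_index_eq)
  then show ?thesis unfolding eq by (rule card_image)
qed

end

section \<open>Cyclic lists with the fewest gaps\<close>

locale minimal_gaps = pair_graph G for G :: "'a pair_pre_digraph" +
  fixes S :: "'a set" and m :: nat
  assumes S_large: "3 \<le> card S" and S_verts: "S \<subseteq> pverts G"
    and minimal: "linked_cycle G S xs \<Longrightarrow> m \<le> cyclic_gaps G xs"
begin

text \<open>A cyclic list with the minimal number of gaps, cut open at one of its gaps.\<close>

definition opened :: "'a list \<Rightarrow> bool" where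
  "opened xs \<longleftrightarrow> linked_cycle G S xs \<and> cyclic_gaps G xs = m \<and> (last xs, hd xs) \<notin> parcs G"

lemma openedD:
  assumes "opened xs"
  shows "xs \<noteq> []" "distinct xs" "set xs \<subseteq> pverts G" "m = Suc (gaps G xs)"
    "heavy G (hd xs)" "heavy G (last xs)" "(last xs, hd xs) \<notin> parcs G" "(hd xs, last xs) \<notin> parcs G"
  using assms arcs_symmetric[of "hd xs" "last xs"]
  by (auto simp: opened_def linked_cycle_eq cyclic_gaps_eq linked_def)

text \<open>
  The closing pair adds at most one gap, so by minimality fewer than \<open>m\<close> gaps inside the list mean
  exactly \<open>m - 1\<close> of them and a gap at the closing pair. New opened lists are obtained in this way.
\<close>

lemma openedI:
  assumes "linked_cycle G S xs" and "gaps G xs < m"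
  shows "opened xs"
  using assms(2) minimal[OF assms(1)] assms(1)
  by (auto simp: opened_def cyclic_gaps_eq linked_cycle_eq split: if_splits)

lemma opened_rev: "opened xs \<Longrightarrow> opened (rev xs)"
  using openedD(1,8)[of xs]
  by (auto simp: opened_def linked_cycle_rev cyclic_gaps_rev hd_rev last_rev)

lemma no_crossing:
  assumes "opened (ps @ qs)" and "ps \<noteq> []" and "qs \<noteq> []"
    and "(hd ps, hd qs) \<in> parcs G" and "(last qs, last ps) \<in> parcs G"
  shows False
proof -
  have "linked_cycle G S (rev ps @ qs)"
    using assms by (intro linked_cycle_flip) (auto simp: opened_def linked_def)
  from minimal[OF this] show False
    using assms openedD(4)[OF assms(1)] by (simp add: cyclic_gaps_flip gaps_append)
qed

text \<open>
  If the first vertex \<open>u\<close> is adjacent to \<open>y\<close>, reversing the part before \<open>y\<close> uses the edge \<open>uy\<close> and turns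
  the predecessor of \<open>y\<close> into the first vertex. That predecessor must be heavy to be linked to the
  last vertex of the list.
\<close>

lemma opened_flip_edge:
  assumes "opened (ps @ qs)" and "ps \<noteq> []" and "qs \<noteq> []"
    and "(hd ps, hd qs) \<in> parcs G" and "heavy G (last ps)"
  shows "opened (rev ps @ qs)"
proof (rule openedI)
  show "linked_cycle G S (rev ps @ qs)"
    using assms openedD(6)[OF assms(1)]
    by (intro linked_cycle_flip) (auto simp: opened_def linked_def)
  show "gaps G (rev ps @ qs) < m"
    using assms openedD(4)[OF assms(1)] by (simp add: gaps_append gaps_rev last_rev)
qed

text \<open>Otherwise the flip would remove the gap in front of the neighbour without creating a new one.\<close>

lemma pred_of_nbr_adjacent:
  assumes "opened (ps @ qs)" and "ps \<noteq> []" and "qs \<noteq> []" and "(hd ps, hd qs) \<in> parcs G"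
  shows "(last ps, hd qs) \<in> parcs G"
proof (rule ccontr)
  assume gap: "(last ps, hd qs) \<notin> parcs G"
  then have "heavy G (last ps)"
    using assms by (auto simp: opened_def linked_cycle_append linked_def)
  then have "opened (rev ps @ qs)" using assms opened_flip_edge by blast
  then have "m = Suc (gaps G (rev ps @ qs))" by (rule openedD)
  moreover have "m = Suc (gaps G (ps @ qs))" using assms(1) by (rule openedD)
  ultimately show False using assms gap by (simp add: gaps_append gaps_rev last_rev)
qed

text \<open>
  Both ends of an opened list and both vertices of any gap are heavy, hence linked to each other;
  so the segments between two gaps may be reversed freely.
\<close>

lemma opened_flip_gap:
  assumes "opened (ps @ qs)" and "ps \<noteq> []" and "qs \<noteq> []" and "(last ps, hd qs) \<notin> parcs G"
  shows "opened (rev ps @ qs)"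
proof (rule openedI)
  have hv: "heavy G (last ps)" "heavy G (hd qs)"
    using assms by (auto simp: opened_def linked_cycle_append linked_def)
  show "linked_cycle G S (rev ps @ qs)"
    using assms hv openedD(5,6)[OF assms(1)]
    by (intro linked_cycle_flip) (auto simp: opened_def linked_def)
  show "gaps G (rev ps @ qs) < m"
    using assms openedD(4)[OF assms(1)] by (simp add: gaps_append gaps_rev last_rev)
qed

lemma opened_Cons:
  assumes "opened xs" and "y \<notin> set xs" and "(hd xs, y) \<in> parcs G" and "heavy G y"
  shows "opened (y # xs)"
proof (rule openedI)
  have e: "(y, hd xs) \<in> parcs G" using assms(3) by (rule arcs_symmetric)
  show "linked_cycle G S (y # xs)"
    using assms e openedD(6)[OF assms(1)]
    by (intro linked_cycle_Cons) (auto simp: opened_def linked_def)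
  show "gaps G (y # xs) < m"
    using openedD(1,4)[OF assms(1)] e by (simp add: gaps_Cons)
qed

lemma no_common_outside_nbr:
  assumes "opened xs" and "y \<notin> set xs" and "(hd xs, y) \<in> parcs G" and "(last xs, y) \<in> parcs G"
  shows False
proof -
  have e: "(y, hd xs) \<in> parcs G" using assms(3) by (rule arcs_symmetric)
  have "linked_cycle G S (y # xs)"
    using assms e by (intro linked_cycle_Cons) (auto simp: opened_def linked_def)
  from minimal[OF this] show False
    using openedD(1,4)[OF assms(1)] e assms(4) by (simp add: cyclic_gaps_Cons)
qed

text \<open>
  Without crossings the two ends have at most \<open>length xs - 1\<close> neighbours on the list, counted
  together, and without common outside neighbours at most \<open>n - length xs\<close> off it. The total \<open>n - 1\<close>
  is too small for two degrees of at least \<open>n/2\<close>.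
\<close>

lemma not_both_ends_high_degree:
  assumes "opened xs" and "high_degree G (hd xs)" and "high_degree G (last xs)"
  shows False
proof -
  let ?a = "hd xs" and ?b = "last xs"
  let ?A = "{j. Suc j < length xs \<and> (?a, xs ! Suc j) \<in> parcs G}"
  let ?B = "{j. Suc j < length xs \<and> (?b, xs ! j) \<in> parcs G}"
  note op = openedD[OF assms(1)]
  have finV: "finite (pverts G)" by (rule pair_finite_verts)
  have "?A \<inter> ?B = {}"
  proof (rule ccontr)
    assume "?A \<inter> ?B \<noteq> {}"
    then obtain j where j: "Suc j < length xs" "(?a, xs ! Suc j) \<in> parcs G" "(?b, xs ! j) \<in> parcs G"
      by blast
    from j(1) obtain ps qs where "xs = ps @ qs" "ps \<noteq> []" "qs \<noteq> []"
        "last ps = xs ! j" "hd qs = xs ! Suc j" by (rule split_at)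
    then show False using no_crossing[of ps qs] assms(1) j(2,3) by auto
  qed
  then have "card ?A + card ?B = card (?A \<union> ?B)"
    by (subst card_Un_disjoint) (auto intro: finite_subset[of _ "{..<length xs}"])
  also have "\<dots> \<le> card {..<length xs - 1}" by (intro card_mono) auto
  finally have inside: "card ?A + card ?B < length xs" using op(1) by (cases xs) auto
  have "(nbrs G ?a - set xs) \<inter> (nbrs G ?b - set xs) = {}"
    using no_common_outside_nbr[OF assms(1)] by (auto simp: nbrs_def)
  then have "card (nbrs G ?a - set xs) + card (nbrs G ?b - set xs)
      = card ((nbrs G ?a - set xs) \<union> (nbrs G ?b - set xs))"
    by (subst card_Un_disjoint) auto
  also have "\<dots> \<le> card (pverts G - set xs)"
    using finV by (intro card_mono) (auto simp: nbrs_def dest: in_arcsD2)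
  also have "\<dots> = card (pverts G) - length xs"
    using op(2,3) by (simp add: card_Diff_subset distinct_card)
  finally have outside:
    "card (nbrs G ?a - set xs) + card (nbrs G ?b - set xs) \<le> card (pverts G) - length xs" .
  have "length xs \<le> card (pverts G)"
    using op(2,3) finV by (metis card_mono distinct_card)
  moreover have "vdeg G ?a = card ?A + card (nbrs G ?a - set xs)"
    using card_hd_nbrs_in_path[OF op(2,1)] card_Int_Diff[of "nbrs G ?a" "set xs"]
    by (simp add: vdeg_def)
  moreover have "vdeg G ?b = card ?B + card (nbrs G ?b - set xs)"
    using card_last_nbrs_in_path[OF op(2,1)] card_Int_Diff[of "nbrs G ?b" "set xs"]
    by (simp add: vdeg_def)
  ultimately show False
    using inside outside assms(2,3) by (simp add: high_degree_def)
qed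

text \<open>
  In the proof, \<open>T\<close> collects the vertices other than \<open>u\<close> that can be made first vertex through a
  neighbour of \<open>u\<close>. If none of them has high degree, the last neighbour \<open>w\<close> of \<open>u\<close> on the list
  does, and it is followed by a gap, at which the list can be flipped to begin with \<open>w\<close>.
\<close>

lemma high_degree_hd:
  assumes xs: "opened xs"
  shows "\<exists>ys. opened ys \<and> last ys = last xs \<and> high_degree G (hd ys)"
proof (rule ccontr)
  assume none: "\<nexists>ys. opened ys \<and> last ys = last xs \<and> high_degree G (hd ys)"
  note op = openedD[OF xs]
  let ?u = "hd xs"
  let ?N = "nbrs G ?u"
  let ?A = "{j. Suc j < length xs \<and> (?u, xs ! Suc j) \<in> parcs G}"
  let ?P = "(\<lambda>j. xs ! j) ` ?A"
  define T where "T = (?P \<union> (?N - set xs)) - {?u}"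
  have u_low: "\<not> high_degree G ?u" using none xs by blast
  have flip_low: "\<not> high_degree G (last ps)"
    if "xs = ps @ qs" "ps \<noteq> []" "qs \<noteq> []" "opened (rev ps @ qs)" for ps qs
  proof
    assume h: "high_degree G (last ps)"
    have "last (rev ps @ qs) = last xs" and "hd (rev ps @ qs) = last ps"
      using that by (simp_all add: hd_rev)
    with that(4) h have "\<exists>ys. opened ys \<and> last ys = last xs \<and> high_degree G (hd ys)"
      by (intro exI[of _ "rev ps @ qs"]) simp
    with none show False ..
  qed
  have P: "\<not> high_degree G p \<and> (p = ?u \<or> p \<in> ?N \<union> nbrs2 G ?u)" if "p \<in> ?P" for p
  proof -
    from that obtain j where j: "Suc j < length xs" "(?u, xs ! Suc j) \<in> parcs G" "p = xs ! j"
      by blast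
    from j(1) obtain ps qs where s: "xs = ps @ qs" "ps \<noteq> []" "qs \<noteq> []"
        "last ps = xs ! j" "hd qs = xs ! Suc j" by (rule split_at)
    have hd: "(hd ps, hd qs) \<in> parcs G" using s j(2) by simp
    have "opened (ps @ qs)" using xs s(1) by simp
    then have "(p, xs ! Suc j) \<in> parcs G"
      using pred_of_nbr_adjacent[of ps qs] s hd j(3) by simp
    then have "p = ?u \<or> p \<in> ?N \<union> nbrs2 G ?u"
      using mem_nbrs2I[OF j(2), of p] arcs_symmetric by blast
    moreover have "\<not> high_degree G p"
    proof
      assume h: "high_degree G p"
      then have "opened (rev ps @ qs)"
        using opened_flip_edge[of ps qs] \<open>opened (ps @ qs)\<close> s hd j(3)
        by (simp add: high_degree_imp_heavy)
      then show False using flip_low s h j(3) by metis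
    qed
    ultimately show ?thesis by blast
  qed
  have out: "\<not> high_degree G y" if "y \<in> ?N - set xs" for y
  proof
    assume h: "high_degree G y"
    then have "opened (y # xs)"
      using that xs by (intro opened_Cons) (auto simp: nbrs_def high_degree_imp_heavy)
    then show False using none h op(1) by (metis last_ConsR list.sel(1))
  qed
  have finA: "finite ?A" by (auto intro: finite_subset[of _ "{..<length xs}"])
  have card_T: "vdeg G ?u = card (?P \<union> (?N - set xs))"
  proof -
    have "inj_on (\<lambda>j. xs ! j) ?A"
      using op(2) by (auto simp: inj_on_def nth_eq_iff_index_eq)
    then have "card ?P = card (?N \<inter> set xs)"
      unfolding card_hd_nbrs_in_path[OF op(2,1)] by (rule card_image)
    moreover have "card (?P \<union> (?N - set xs)) = card ?P + card (?N - set xs)"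
      using finA by (intro card_Un_disjoint) auto
    ultimately show ?thesis using card_Int_Diff[of ?N "set xs"] by (simp add: vdeg_def)
  qed
  have T1: "T \<subseteq> ?N \<union> nbrs2 G ?u" unfolding T_def using P by blast
  have T2: "\<not> high_degree G t" if "t \<in> T" for t using that P out unfolding T_def by blast
  have T3: "vdeg G ?u \<le> card T + 1"
    using card_T diff_card_le_card_Diff[of "{?u}" "?P \<union> (?N - set xs)"] by (simp add: T_def)
  have n3: "3 \<le> card (pverts G)"
    using S_large S_verts pair_finite_verts by (meson card_mono order_trans)
  note wit = implicit_degree_witnesses[OF op(5) u_low n3 T1 T2 T3]
  have "?u \<in> ?P \<union> (?N - set xs)"
  proof (rule ccontr)
    assume "?u \<notin> ?P \<union> (?N - set xs)"
    then have "T = ?P \<union> (?N - set xs)" by (simp add: T_def)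
    then show False using wit(1) card_T by simp
  qed
  then have "?A \<noteq> {}" using op(1) by auto
  \<comment> \<open>The last neighbour of \<open>u\<close> on the list is \<open>xs ! Suc j\<close>.\<close>
  define j where "j = Max ?A"
  have jA: "j \<in> ?A" unfolding j_def using finA \<open>?A \<noteq> {}\<close> by (rule Max_in)
  define w where "w = xs ! Suc j"
  have wN: "w \<in> ?N" using jA by (simp add: w_def nbrs_def)
  have last_nbr: "i \<le> j" if "i \<in> ?A" for i unfolding j_def using finA that by (rule Max_ge)
  have idx: "xs ! i \<in> T \<Longrightarrow> i < length xs \<Longrightarrow> xs ! i \<in> ?N - set xs \<or> i \<in> ?A" for i
    using op(2) by (auto simp: T_def nth_eq_iff_index_eq)
  have "w \<notin> T"
    using idx[of "Suc j"] jA last_nbr[of "Suc j"] by (auto simp: w_def)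
  then have w_high: "high_degree G w" using wit(3) wN by blast
  have "Suc (Suc j) < length xs"
  proof (rule ccontr)
    assume "\<not> Suc (Suc j) < length xs"
    then have "length xs = Suc (Suc j)" using jA by simp
    then have "w = last xs" using op(1) by (simp add: w_def last_conv_nth)
    then show False using wN op(8) by (simp add: nbrs_def)
  qed
  then obtain ps qs where s: "xs = ps @ qs" "ps \<noteq> []" "qs \<noteq> []"
      "last ps = w" "hd qs = xs ! Suc (Suc j)"
    unfolding w_def by (rule split_at)
  let ?q = "xs ! Suc (Suc j)"
  have q: "?q \<notin> ?N" "?q \<noteq> ?u" "?q \<notin> T"
  proof -
    show qN: "?q \<notin> ?N"
      using last_nbr[of "Suc j"] \<open>Suc (Suc j) < length xs\<close> by (auto simp: nbrs_def)
    show "?q \<noteq> ?u"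
      using op(1,2) \<open>Suc (Suc j) < length xs\<close> by (simp add: hd_conv_nth nth_eq_iff_index_eq)
    show "?q \<notin> T"
      using idx[of "Suc (Suc j)"] last_nbr[of "Suc (Suc j)"] qN \<open>Suc (Suc j) < length xs\<close> by auto
  qed
  \<comment> \<open>An edge \<open>wq\<close> would put \<open>q\<close> into \<open>N\<^sub>2(u)\<close>, which is contained in \<open>T\<close>.\<close>
  have "(w, ?q) \<notin> parcs G"
    using mem_nbrs2I[of ?u w ?q] wN q wit(2) by (auto simp: nbrs_def)
  then have "opened (rev ps @ qs)" using opened_flip_gap[of ps qs] xs s by simp
  then show False using flip_low s w_high by metis
qed

text \<open>Improving the first vertex keeps the last one, so both ends can be improved in turn.\<close>

lemma no_opened: "\<not> opened xs"
proof
  assume "opened xs"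
  then obtain ys where ys: "opened ys" "high_degree G (hd ys)" using high_degree_hd by blast
  then obtain zs where zs: "opened zs" "last zs = last (rev ys)" "high_degree G (hd zs)"
    using high_degree_hd opened_rev by blast
  moreover have "last (rev ys) = hd ys" using openedD(1)[OF ys(1)] by (simp add: last_rev)
  ultimately show False using not_both_ends_high_degree ys by metis
qed

lemma gap_free:
  assumes "linked_cycle G S xs" and "cyclic_gaps G xs = m"
  shows "m = 0"
proof (rule ccontr)
  assume "m \<noteq> 0"
  have ne: "xs \<noteq> []" using assms(1) by (simp add: linked_cycle_eq)
  have "(last xs, hd xs) \<in> parcs G" using no_opened[of xs] assms by (auto simp: opened_def)
  then have "0 < gaps G xs" using assms(2) ne \<open>m \<noteq> 0\<close> by (simp add: cyclic_gaps_eq)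
  then obtain ps qs where s: "xs = ps @ qs" "ps \<noteq> []" "qs \<noteq> []" "(last ps, hd qs) \<notin> parcs G"
    using gap_split by blast
  then have "opened (qs @ ps)"
    using assms by (auto simp: opened_def linked_cycle_rotate cyclic_gaps_rotate[of qs ps])
  then show False using no_opened by blast
qed

end

lemma (in pair_graph) cyclable_if_linked_cycle:
  assumes "linked_cycle G S xs" and "3 \<le> card S"
  shows "cyclable G S"
proof -
  obtain ys where ys: "linked_cycle G S ys"
    and least: "\<And>zs. linked_cycle G S zs \<Longrightarrow> cyclic_gaps G ys \<le> cyclic_gaps G zs"
    using ex_has_least_nat[of "linked_cycle G S" xs "cyclic_gaps G"] assms(1) by blast
  interpret minimal_gaps G S "cyclic_gaps G ys"
    using assms(2) ys least by unfold_locales (auto simp: linked_cycle_def)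
  show ?thesis using cyclable_if_gap_free[OF ys assms(2)] gap_free[OF ys] by simp
qed

lemma id_cycle_imp_linked_cycle:
  assumes "id_cycle G vs"
  shows "linked_cycle G (set vs) vs"
proof -
  let ?p = "length vs"
  have p: "3 \<le> ?p" and vs: "distinct vs" "set vs \<subseteq> pverts G"
    using assms by (auto simp: id_cycle_def)
  have half: "real k / 2 \<le> real d \<longleftrightarrow> k \<le> 2 * d" for k d :: nat by linarith
  have link: "linked G (vs ! i) (vs ! ((i + 1) mod ?p))" if "i < ?p" for i
    using assms that by (auto simp: id_cycle_def Let_def linked_def heavy_def half)
  have "linked G (vs ! i) (vs ! Suc i)" if "Suc i < ?p" for i
    using link[of i] that by simp
  then have "successively (linked G) vs" by (simp add: successively_conv_nth)
  moreover have "linked G (last vs) (hd vs)"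
  proof -
    have "vs \<noteq> []" using p by auto
    then show ?thesis
      using link[of "?p - 1"] p by (simp add: last_conv_nth hd_conv_nth)
  qed
  ultimately show ?thesis using p vs by (auto simp: linked_cycle_eq)
qed

theorem theorem6:
  fixes G :: "'a pair_pre_digraph" and vs :: "'a list"
  assumes "pair_graph G"
    and "id_cycle G vs"
  shows "cyclable G (set vs)"
proof -
  have "card (set vs) = length vs" using assms(2) by (simp add: id_cycle_def distinct_card)
  then show ?thesis
    using pair_graph.cyclable_if_linked_cycle[OF assms(1) id_cycle_imp_linked_cycle[OF assms(2)]]
      assms(2) by (simp add: id_cycle_def)
qed

end
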